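(* Let $\mathbb{F}_q$ be a finite field of odd characteristic and $c\in\mathbb{F}_q$ nonzero. Let $f:\mathbb{F}_q\to\mathbb{F}_q$ be $f(R)=R(4c-R)$ and $S=\{R\in\mathbb{F}_q: f(R) \text{ is not a square in } \mathbb{F}_q\}$ (so $0\notin S$). Then it is possible to pack $k$ distinct pairwise disjoint circles of radius $c$ in the plane $\mathbb{F}_q^2$ with nonzero distance between any two centers if and only if there exist $k$ distinct points of $\mathbb{F}_q^2$ (vertices of a $(k-1)$-simplex) all of whose pairwise distances lie in $S$. In that case, the packing is achieved by placing the $k$ circles of radius $c$ centered at these $k$ points.
   Context: For $v=(v_1,v_2)\in\mathbb{F}_q^2$, $\|v\|=v_1^2+v_2^2$, and the distance between points $x,y$ is $\|x-y\|$. The circle of radius $R$ and center $u$ is $\{x\in\mathbb{F}_q^2: \|x-u\|=R\}$. A packing of circles means a collection of pairwise disjoint circles. *)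

theory Defs
  imports
    "HOL-Computational_Algebra.Computational_Algebra"
    "HOL-Library.Product_Plus"
    "HOL-Library.Disjoint_Sets"
begin

definition sqnorm :: "'a::finite_field \<times> 'a \<Rightarrow> 'a" where
  "sqnorm v = (fst v)\<^sup>2 + (snd v)\<^sup>2"

definition sqdist :: "'a::finite_field \<times> 'a \<Rightarrow> 'a \<times> 'a \<Rightarrow> 'a" where
  "sqdist x y = sqnorm (x - y)"

text \<open>The radius is compared with the squared norm itself; it is not squared.\<close>

definition circle :: "'a::finite_field \<Rightarrow> 'a \<times> 'a \<Rightarrow> ('a \<times> 'a) set" where
  "circle R u = {x. sqdist x u = R}"

text \<open>Packings are given by their sets of centers, because the condition on the distances
  between centers refers to a chosen center for each circle. Injectivity says that
  different centers give different circles, so there are exactly \<open>k\<close> circles.\<close>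

definition circle_packing :: "'a::finite_field \<Rightarrow> nat \<Rightarrow> ('a \<times> 'a) set \<Rightarrow> bool" where
  "circle_packing c k P \<longleftrightarrow>
     card P = k \<and> inj_on (circle c) P \<and> disjoint (circle c ` P) \<and>
     pairwise (\<lambda>u v. sqdist u v \<noteq> 0) P"

definition f :: "'a::finite_field \<Rightarrow> 'a \<Rightarrow> 'a" where
  "f c R = R * (4 * c - R)"

definition S :: "'a::finite_field \<Rightarrow> 'a set" where
  "S c = {R. \<not> is_square (f c R)}"

definition simplex_with_distances :: "'a::finite_field set \<Rightarrow> nat \<Rightarrow> ('a \<times> 'a) set \<Rightarrow> bool" where
  "simplex_with_distances D k P \<longleftrightarrow> card P = k \<and> pairwise (\<lambda>u v. sqdist u v \<in> D) P"

end

theory Submission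
  imports Defs
begin

text \<open>Let \<open>R \<noteq> 0\<close> be the distance between the centers \<open>u\<close> and \<open>v\<close>. In the orthogonal coordinates
  given by \<open>v - u\<close> and its rotation by a right angle, the common points of the two circles of
  radius \<open>c\<close> are \<open>u + (v - u) / 2 + t (v - u)\<^sup>\<bottom>\<close> with \<open>(2 R t)\<^sup>2 = R (4 c - R)\<close>; hence the circles
  meet if and only if \<open>f(R)\<close> is a square. Moreover circles are nonempty, because every
  element of a finite field of odd characteristic is a sum of two squares, so disjoint circles
  are automatically distinct.\<close>

lemma two_neq_zero_if_odd_char:
  assumes "odd CHAR('a::field)"
  shows "(2::'a) \<noteq> 0"
proof
  assume "(2::'a) = 0"
  then have "CHAR('a) dvd 2"
    using of_nat_eq_0_iff_char_dvd[of 2, where 'a = 'a] by simp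
  then have "CHAR('a) = 1"
    using assms by (metis dvd_refl prime_nat_iff two_is_prime_nat)
  then show False by simp
qed

text \<open>The fibers of squaring cover the field, and each has at most two elements,
  \<open>z\<close> and \<open>- z\<close>.\<close>

lemma card_UNIV_le_twice_card_squares:
  "card (UNIV :: 'a::finite_field set) \<le> 2 * card (range (\<lambda>x::'a. x\<^sup>2))"
proof -
  let ?A = "range (\<lambda>x::'a. x\<^sup>2)"
  have fiber: "card {x::'a. x\<^sup>2 = y} \<le> 2" if "y \<in> ?A" for y
  proof -
    from that obtain z where "y = z\<^sup>2" by blast
    then have "{x. x\<^sup>2 = y} = {z, - z}" by (auto simp: power2_eq_iff)
    then show ?thesis by (simp add: card_insert_if)
  qed
  have "card (UNIV :: 'a set) = card (\<Union>y\<in>?A. {x::'a. x\<^sup>2 = y})"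
    by (rule arg_cong[where f = card]) auto
  also have "\<dots> \<le> (\<Sum>y\<in>?A. card {x::'a. x\<^sup>2 = y})"
    by (rule card_UN_le) simp
  also have "\<dots> \<le> 2 * card ?A"
    using sum_bounded_above[of ?A "\<lambda>y. card {x::'a. x\<^sup>2 = y}" 2] fiber by simp
  finally show ?thesis .
qed

text \<open>Pigeonhole: a common element of the squares and their reflection under
  \<open>x \<mapsto> c - x\<close> gives a representation of \<open>c\<close>. Each of these sets
  has at least half the elements of the field.\<close>

lemma sum_of_two_squares_finite_field:
  fixes c :: "'a::finite_field"
  assumes two: "(2::'a) \<noteq> 0"
  obtains a b where "a\<^sup>2 + b\<^sup>2 = c"
proof (rule ccontr)
  assume "\<not> thesis"
  with that have none: "a\<^sup>2 + b\<^sup>2 \<noteq> c" for a b by blast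
  let ?A = "range (\<lambda>x::'a. x\<^sup>2)"
  let ?B = "(\<lambda>x. c - x) ` ?A"
  have disj: "?A \<inter> ?B = {}"
    using none by (auto simp: algebra_simps)
  \<comment> \<open>The fixed point \<open>c / 2\<close> of \<open>x \<mapsto> c - x\<close> lies outside both sets; this makes the count strict.\<close>
  have half: "c / 2 + c / 2 = c"
    using two by (simp add: field_simps)
  \<comment> \<open>Otherwise \<open>c / 2 = z\<^sup>2\<close> would give
    \<open>z\<^sup>2 + z\<^sup>2 = c\<close>.\<close>
  have "c / 2 \<notin> ?A"
    using none half by (metis imageE)
  moreover have "c / 2 \<notin> ?B"
  proof
    assume "c / 2 \<in> ?B"
    then obtain z where "c / 2 = c - z\<^sup>2" by blast
    then have "z\<^sup>2 = c / 2" using half by (metis add_diff_cancel_left' diff_diff_eq2 diff_add_cancel)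
    then show False using none half by metis
  qed
  ultimately have "card (insert (c / 2) (?A \<union> ?B)) = Suc (card ?A + card ?B)"
    using disj by (simp add: card_Un_disjoint)
  moreover have "card ?B = card ?A"
    by (rule card_image) (simp add: inj_on_def)
  moreover have "card (insert (c / 2) (?A \<union> ?B)) \<le> card (UNIV :: 'a set)"
    by (rule card_mono) auto
  ultimately show False
    using card_UNIV_le_twice_card_squares[where 'a = 'a] by linarith
qed

lemma circle_nonempty:
  fixes c :: "'a::finite_field"
  assumes "(2::'a) \<noteq> 0"
  shows "circle c u \<noteq> {}"
proof -
  obtain a b where "a\<^sup>2 + b\<^sup>2 = c"
    using sum_of_two_squares_finite_field[OF assms] .
  then have "u + (a, b) \<in> circle c u"
    by (simp add: circle_def sqdist_def sqnorm_def)
  then show ?thesis by blast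
qed

lemma circles_intersect_iff:
  fixes c :: "'a::finite_field"
  assumes two: "(2::'a) \<noteq> 0" and R: "sqdist u v \<noteq> 0"
  shows "circle c u \<inter> circle c v \<noteq> {} \<longleftrightarrow> is_square (f c (sqdist u v))"
proof -
  obtain u1 u2 v1 v2 where uv: "u = (u1, u2)" "v = (v1, v2)"
    by (cases u, cases v)
  define a where "a = v1 - u1"
  define b where "b = v2 - u2"
  have v: "v1 = u1 + a" "v2 = u2 + b" by (simp_all add: a_def b_def)
  define r where "r = a\<^sup>2 + b\<^sup>2"
  have dist: "sqdist u v = r"
    by (simp add: uv v sqdist_def sqnorm_def r_def)
  with R have r: "r \<noteq> 0" by simp
  show ?thesis
  proof
    assume "circle c u \<inter> circle c v \<noteq> {}"
    then obtain x1 x2 where "(x1, x2) \<in> circle c u" "(x1, x2) \<in> circle c v" by auto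
    then have on_u: "(x1 - u1)\<^sup>2 + (x2 - u2)\<^sup>2 = c"
      and on_v: "(x1 - u1 - a)\<^sup>2 + (x2 - u2 - b)\<^sup>2 = c"
      by (simp_all add: circle_def sqdist_def sqnorm_def uv v diff_diff_eq)
    define p where "p = x1 - u1"
    define q where "q = x2 - u2"
    have c: "c = p\<^sup>2 + q\<^sup>2"
      using on_u by (simp add: p_def q_def)
    have "(p - a)\<^sup>2 + (q - b)\<^sup>2 = p\<^sup>2 + q\<^sup>2"
      using on_v c by (simp add: p_def q_def)
    \<comment> \<open>The quadratic terms in \<open>p\<close> and \<open>q\<close> cancel, leaving
      the radical axis of the two circles.\<close>
    then have "r = 2 * (a * p + b * q)"
      unfolding r_def by algebra
    then have "r * (4 * c - r) = 4 * (r * c - (a * p + b * q)\<^sup>2)"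
      by algebra
    \<comment> \<open>Lagrange's identity for the vectors \<open>(a, b)\<close> and
      \<open>(p, q)\<close>.\<close>
    also have "\<dots> = (2 * (a * q - b * p))\<^sup>2"
      unfolding r_def c by algebra
    finally have "r * (4 * c - r) = (2 * (a * q - b * p))\<^sup>2" .
    then show "is_square (f c (sqdist u v))"
      by (auto simp: f_def dist is_nth_power_def)
  next
    assume "is_square (f c (sqdist u v))"
    then obtain y where y: "r * (4 * c - r) = y\<^sup>2"
      by (auto simp: f_def dist is_nth_power_def)
    define t where "t = y / (2 * r)"
    \<comment> \<open>From here on one half enters only through \<open>2 * h = 1\<close>, so the
      remaining claims are polynomial.\<close>
    define h where "h = 1 / (2::'a)"
    have h: "2 * h = 1" using two by (simp add: h_def)
    have "2 * r * t = y" using two r by (simp add: t_def)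
    with y have "r * (4 * c - r) = r * (4 * r * t\<^sup>2)" by algebra
    with r have "4 * c - r = 4 * r * t\<^sup>2" by simp
    then have four_c: "4 * c = r + 4 * r * t\<^sup>2" by (simp add: algebra_simps)
    have h2: "4 * h\<^sup>2 = 1" using h by algebra
    have "c = 4 * h\<^sup>2 * c" by (simp add: h2)
    also have "\<dots> = h\<^sup>2 * (4 * c)" by (simp add: mult_ac)
    also have "\<dots> = r * h\<^sup>2 + 4 * h\<^sup>2 * (r * t\<^sup>2)" unfolding four_c by algebra
    also have "\<dots> = r * (h\<^sup>2 + t\<^sup>2)" by (simp add: h2 distrib_left)
    finally have "c = r * (h\<^sup>2 + t\<^sup>2)" .
    \<comment> \<open>The offset from \<open>u\<close> is \<open>h\<close> times
      \<open>(a, b)\<close> plus \<open>t\<close> times the orthogonal vector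
      \<open>(- b, a)\<close>; both vectors have squared norm \<open>r\<close>.\<close>
    then have c: "c = (h * a - t * b)\<^sup>2 + (h * b + t * a)\<^sup>2"
      unfolding r_def by algebra
    \<comment> \<open>Seen from \<open>v\<close>, the coefficient \<open>h\<close> becomes
      \<open>h - 1 = - h\<close>, which has the same square.\<close>
    moreover from c h have "c = (h * a - t * b - a)\<^sup>2 + (h * b + t * a - b)\<^sup>2"
      by algebra
    ultimately have "(u1 + (h * a - t * b), u2 + (h * b + t * a)) \<in> circle c u \<inter> circle c v"
      by (simp add: circle_def sqdist_def sqnorm_def uv v)
    then show "circle c u \<inter> circle c v \<noteq> {}" by blast
  qed
qed

lemma zero_notin_S: "0 \<notin> S c"
  by (simp add: S_def f_def)

text \<open>Keeping the same \<open>P\<close> on both sides yields the explicit placement of the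
  circles as well as the equivalence of existence.\<close>

lemma circle_packing_iff_simplex:
  fixes c :: "'a::finite_field"
  assumes two: "(2::'a) \<noteq> 0"
  shows "circle_packing c k P \<longleftrightarrow> simplex_with_distances (S c) k P"
proof
  assume P: "circle_packing c k P"
  have "sqdist u v \<in> S c" if "u \<in> P" "v \<in> P" "u \<noteq> v" for u v
  proof -
    have "circle c u \<noteq> circle c v"
      using P that by (auto simp: circle_packing_def dest: inj_onD)
    then have "circle c u \<inter> circle c v = {}"
      using P that by (auto simp: circle_packing_def disjoint_def)
    moreover have "sqdist u v \<noteq> 0"
      using P that by (auto simp: circle_packing_def pairwise_def)
    ultimately show ?thesis
      using circles_intersect_iff[OF two, of u v c] by (simp add: S_def)
  qed
  with P show "simplex_with_distances (S c) k P"
    by (simp add: circle_packing_def simplex_with_distances_def pairwise_def)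
next
  assume P: "simplex_with_distances (S c) k P"
  have dist: "sqdist u v \<noteq> 0" and disj: "circle c u \<inter> circle c v = {}"
    if "u \<in> P" "v \<in> P" "u \<noteq> v" for u v
  proof -
    have in_S: "sqdist u v \<in> S c"
      using P that by (simp add: simplex_with_distances_def pairwise_def)
    then show "sqdist u v \<noteq> 0"
      using zero_notin_S by metis
    with in_S show "circle c u \<inter> circle c v = {}"
      using circles_intersect_iff[OF two, of u v c] by (simp add: S_def)
  qed
  \<comment> \<open>If distinct centers gave equal circles, that circle would be disjoint from
    itself, hence empty.\<close>
  have "inj_on (circle c) P"
    using disj circle_nonempty[OF two] by (intro inj_onI) (metis Int_absorb)
  moreover have "disjoint (circle c ` P)"
    using disj by (intro disjointI) (metis imageE)
  ultimately show "circle_packing c k P"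
    using P dist by (simp add: circle_packing_def simplex_with_distances_def pairwise_def)
qed

theorem mainTheorem9:
  fixes c :: "'a::finite_field" and k :: nat
  assumes "odd CHAR('a)" and "c \<noteq> 0"
  shows "0 \<notin> S c \<and>
         ((\<exists>P. circle_packing c k P) \<longleftrightarrow> (\<exists>P. simplex_with_distances (S c) k P)) \<and>
         (\<forall>P. simplex_with_distances (S c) k P \<longrightarrow> circle_packing c k P)"
  using zero_notin_S circle_packing_iff_simplex[OF two_neq_zero_if_odd_char[OF assms(1)]]
  by blast

end
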